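(* Let $n\ge 1$ and let $f,g\in A^+(B_n)_n$. With $\mathcal{R},\mathcal{L},\mathcal{D}$ denoting Green's relations on the additive semigroup $(A^+(B_n),+)$, and $L_f$ the $\mathcal{L}$-class of $f$: (1) $f\,\mathcal{R}\,g$ if and only if $\mathrm{supp}(f)=\mathrm{supp}(g)$ and $(\alpha f)\pi_1=(\alpha g)\pi_1$ for all $\alpha\in\mathrm{supp}(f)$; (2) $L_f=\{f\}$; (3) $f\,\mathcal{D}\,g$ if and only if $f\,\mathcal{R}\,g$.
   Context: For $n\ge 1$ let $[n]=\{1,\dots,n\}$. The Brandt semigroup $(B_n,+)$ has underlying set $B_n=([n]\times[n])\cup\{\vartheta\}$ with $(i,j)+(k,l)=(i,l)$ if $j=k$, $(i,j)+(k,l)=\vartheta$ if $j\ne k$, and $\alpha+\vartheta=\vartheta+\alpha=\vartheta$ for all $\alpha\in B_n$. $M(B_n)$ is the set of all maps $B_n\to B_n$; arguments are written on the left of functions. It carries pointwise addition $\alpha(f+g)=\alpha f+\alpha g$ and composition $\alpha(f\circ g)=(\alpha f)g$. An affine map over $B_n$ is a map of the form $g+h$ with $g$ an endomorphism of the semigroup $(B_n,+)$ (not required to fix $\vartheta$) and $h\in M(B_n)$ a constant map. $A^+(B_n)$ (the affine near-semiring over $B_n$) is the smallest subset of $M(B_n)$ that contains all affine maps and is closed under $+$ and $\circ$. The support of $f\in M(B_n)$ is $\mathrm{supp}(f)=\{\alpha\in B_n : \alpha f\neq\vartheta\}$, and $A^+(B_n)_k$ is the set of $f\in A^+(B_n)$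 with $|\mathrm{supp}(f)|=k$. The projection $\pi_1:[n]\times[n]\to[n]$ is $(p,q)\pi_1=p$. *)

theory Defs
  imports "HOL-Library.FuncSet"
begin

text \<open>
  The absorbing element \<open>\<vartheta>\<close> of the Brandt semigroup is \<^const>\<open>None\<close>; the other
  elements are pairs over \<open>{1..n}\<close>.
\<close>

type_synonym brandt = "(nat \<times> nat) option"

abbreviation brandt_zero :: brandt ("\<vartheta>")
  where "\<vartheta> \<equiv> None"

definition brandt_carrier :: "nat \<Rightarrow> brandt set"
  where "brandt_carrier n = insert \<vartheta> (Some ` ({1..n} \<times> {1..n}))"

fun brandt_add :: "brandt \<Rightarrow> brandt \<Rightarrow> brandt" (infixl "+\<^sub>B" 65)
  where
    "Some (i, j) +\<^sub>B Some (k, l) = (if j = k then Some (i, l) else \<vartheta>)"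
  | "None +\<^sub>B y = \<vartheta>"
  | "x +\<^sub>B None = \<vartheta>"

text \<open>
  Maps \<open>B\<^sub>n \<rightarrow> B\<^sub>n\<close> are extensional functions, so that equality in HOL is
  equality of maps on \<open>B\<^sub>n\<close>.
\<close>

definition brandt_maps :: "nat \<Rightarrow> (brandt \<Rightarrow> brandt) set"
  where "brandt_maps n = brandt_carrier n \<rightarrow>\<^sub>E brandt_carrier n"

definition ptwise_add :: "nat \<Rightarrow> (brandt \<Rightarrow> brandt) \<Rightarrow> (brandt \<Rightarrow> brandt) \<Rightarrow> (brandt \<Rightarrow> brandt)"
  where "ptwise_add n f g = (\<lambda>\<alpha>\<in>brandt_carrier n. f \<alpha> +\<^sub>B g \<alpha>)"

text \<open>Arguments are written on the left in the source: \<open>left_comp n f g\<close> applies \<open>f\<close> first.\<close>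

definition left_comp :: "nat \<Rightarrow> (brandt \<Rightarrow> brandt) \<Rightarrow> (brandt \<Rightarrow> brandt) \<Rightarrow> (brandt \<Rightarrow> brandt)"
  where "left_comp n f g = compose (brandt_carrier n) g f"

definition brandt_endos :: "nat \<Rightarrow> (brandt \<Rightarrow> brandt) set"
  where "brandt_endos n = {g \<in> brandt_maps n.
    \<forall>\<alpha>\<in>brandt_carrier n. \<forall>\<beta>\<in>brandt_carrier n. g (\<alpha> +\<^sub>B \<beta>) = g \<alpha> +\<^sub>B g \<beta>}"

definition constant_maps :: "nat \<Rightarrow> (brandt \<Rightarrow> brandt) set"
  where "constant_maps n = {(\<lambda>\<alpha>\<in>brandt_carrier n. c) | c. c \<in> brandt_carrier n}"

definition affine_maps :: "nat \<Rightarrow> (brandt \<Rightarrow> brandt) set"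
  where "affine_maps n = {ptwise_add n g h | g h. g \<in> brandt_endos n \<and> h \<in> constant_maps n}"

inductive_set affine_nsr :: "nat \<Rightarrow> (brandt \<Rightarrow> brandt) set" for n
  where
    affine: "f \<in> affine_maps n \<Longrightarrow> f \<in> affine_nsr n"
  | add: "f \<in> affine_nsr n \<Longrightarrow> g \<in> affine_nsr n \<Longrightarrow> ptwise_add n f g \<in> affine_nsr n"
  | comp: "f \<in> affine_nsr n \<Longrightarrow> g \<in> affine_nsr n \<Longrightarrow> left_comp n f g \<in> affine_nsr n"

definition supp :: "nat \<Rightarrow> (brandt \<Rightarrow> brandt) \<Rightarrow> brandt set"
  where "supp n f = {\<alpha> \<in> brandt_carrier n. f \<alpha> \<noteq> \<vartheta>}"

definition affine_nsr_supp :: "nat \<Rightarrow> nat \<Rightarrow> (brandt \<Rightarrow> brandt) set"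
  where "affine_nsr_supp n k = {f \<in> affine_nsr n. card (supp n f) = k}"

text \<open>
  Green's relations on a semigroup with carrier \<open>S\<close> and operation \<open>m\<close>.  The principal
  one-sided ideals \<open>a S\<^sup>1\<close> and \<open>S\<^sup>1 a\<close> are \<open>{a} \<union> a S\<close> and \<open>{a} \<union> S a\<close>, whether or not
  \<open>S\<close> already has an identity.
\<close>

definition green_R :: "'a set \<Rightarrow> ('a \<Rightarrow> 'a \<Rightarrow> 'a) \<Rightarrow> ('a \<times> 'a) set"
  where "green_R S m = {(a, b). a \<in> S \<and> b \<in> S \<and>
    insert a {m a s | s. s \<in> S} = insert b {m b s | s. s \<in> S}}"

definition green_L :: "'a set \<Rightarrow> ('a \<Rightarrow> 'a \<Rightarrow> 'a) \<Rightarrow> ('a \<times> 'a) set"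
  where "green_L S m = {(a, b). a \<in> S \<and> b \<in> S \<and>
    insert a {m s a | s. s \<in> S} = insert b {m s b | s. s \<in> S}}"

text \<open>\<open>\<D>\<close> is the join of \<open>\<L>\<close> and \<open>\<R>\<close> in the lattice of equivalence relations on \<open>S\<close>.\<close>

definition green_D :: "'a set \<Rightarrow> ('a \<Rightarrow> 'a \<Rightarrow> 'a) \<Rightarrow> ('a \<times> 'a) set"
  where "green_D S m = \<Inter> {E. equiv S E \<and> green_L S m \<subseteq> E \<and> green_R S m \<subseteq> E}"

end

theory Submission
  imports Defs
begin

text \<open>
  Every element of \<open>A\<^sup>+(B\<^sub>n)\<close> is a constant, or fixes \<open>\<vartheta>\<close> and on its support has a constant
  second coordinate and an injective first coordinate. Elements of support size \<open>n\<close> are of the second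
  kind. Right addition of a constant \<open>(q, r)\<close> therefore moves between any two of them that agree in
  support and first coordinate. Left addition \<open>s + f\<close> keeps the support of \<open>f\<close> only if the constant
  second coordinate of \<open>s\<close> equals the first coordinate of \<open>f\<close> on the whole support, which
  by injectivity forces \<open>n = 1\<close>; so the \<open>\<L>\<close>-classes are trivial and \<open>\<D>\<close> reduces to \<open>\<R>\<close>.
\<close>

section \<open>Green's relations\<close>

text \<open>By associativity and closure, a principal right ideal containing \<open>x\<close>
  contains the whole ideal of \<open>x\<close>. Two such ideals thus coincide once each contains the
  other's generator.\<close>

lemma green_R_iff:
  assumes closed: "\<And>a b. a \<in> S \<Longrightarrow> b \<in> S \<Longrightarrow> m a b \<in> S"
    and assoc: "\<And>a b c. m (m a b) c = m a (m b c)"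
  shows "(a, b) \<in> green_R S m \<longleftrightarrow> a \<in> S \<and> b \<in> S \<and>
    (a = b \<or> (\<exists>s\<in>S. \<exists>t\<in>S. b = m a s \<and> a = m b t))"
proof -
  define I where "I x = insert x {m x s | s. s \<in> S}" for x
  have mem: "x \<in> I y \<longleftrightarrow> x = y \<or> (\<exists>s\<in>S. x = m y s)" for x y
    by (auto simp: I_def)
  have sub: "I x \<subseteq> I y" if "x \<in> I y" for x y
  proof
    fix z assume "z \<in> I x"
    with that show "z \<in> I y"
      unfolding mem by (metis assoc closed)
  qed
  have self: "x \<in> I x" for x
    by (simp add: mem)
  have "I a = I b \<longleftrightarrow> b \<in> I a \<and> a \<in> I b"
    using sub[of a b] sub[of b a] self[of a] self[of b] by blast
  then have "(a, b) \<in> green_R S m \<longleftrightarrow> a \<in> S \<and> b \<in> S \<and> b \<in> I a \<and> a \<in> I b"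
    by (simp add: green_R_def I_def)
  then show ?thesis
    unfolding mem by auto
qed

lemma green_LD:
  assumes "(a, b) \<in> green_L S m"
  shows "b \<in> S \<and> (a = b \<or> (\<exists>s\<in>S. \<exists>t\<in>S. b = m s a \<and> a = m t b))"
proof -
  have "b \<in> S" and eq: "insert a {m s a | s. s \<in> S} = insert b {m s b | s. s \<in> S}"
    using assms by (simp_all add: green_L_def)
  have "b \<in> insert a {m s a | s. s \<in> S}"
    unfolding eq by simp
  moreover have "a \<in> insert b {m s b | s. s \<in> S}"
    unfolding eq[symmetric] by simp
  ultimately show ?thesis using \<open>b \<in> S\<close> by auto
qed

lemma green_L_sym: "(a, b) \<in> green_L S m \<Longrightarrow> (b, a) \<in> green_L S m"
  by (auto simp: green_L_def)

lemma equiv_green_R: "equiv S (green_R S m)"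
  by (rule equivI) (auto simp: green_R_def refl_on_def sym_def trans_def)

lemma green_R_subset_green_D: "green_R S m \<subseteq> green_D S m"
  by (auto simp: green_D_def)

text \<open>The join lies below every equivalence containing both relations. One such equivalence
  keeps the \<R>-classes inside \<open>N\<close> and glues all of \<open>S\<close> outside
  \<open>N\<close> into a single class; at \<open>a\<close> in \<open>N\<close> it agrees with
  \<R>.\<close>

lemma green_D_eq_green_R_if_green_L_trivial:
  assumes triv: "\<And>a. a \<in> N \<Longrightarrow> green_L S m `` {a} = {a}"
    and sat: "\<And>a b. (a, b) \<in> green_R S m \<Longrightarrow> a \<in> N \<longleftrightarrow> b \<in> N"
    and "a \<in> N"
  shows "(a, b) \<in> green_D S m \<longleftrightarrow> (a, b) \<in> green_R S m"
proof
  assume D: "(a, b) \<in> green_D S m"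
  let ?R = "green_R S m"
  let ?E = "?R \<union> (S - N) \<times> (S - N)"
  have R: "refl_on S ?R" "sym ?R" "trans ?R" "?R \<subseteq> S \<times> S"
    using equiv_green_R[of S m] by (auto simp: equiv_def green_R_def)
  have "equiv S ?E"
  proof (rule equivI)
    show "?E \<subseteq> S \<times> S" using R(4) by auto
    show "refl_on S ?E" using R(1) by (auto simp: refl_on_def)
    show "sym ?E" using R(2) by (auto simp: sym_def)
    show "trans ?E"
      \<comment> \<open>Saturation rules out a chain that leaves \<open>N\<close> through an
        \<R>-step and then uses the glued class.\<close>
      using R(3,4) sat by (intro transI) (blast dest: transD)
  qed
  moreover have "green_L S m \<subseteq> ?E"
  proof clarify
    fix x y assume L: "(x, y) \<in> green_L S m" and "(x, y) \<notin> ?R"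
    then have S: "x \<in> S" "y \<in> S" by (auto simp: green_L_def)
    moreover have "x \<noteq> y" using S R(1) \<open>(x, y) \<notin> ?R\<close> by (auto simp: refl_on_def)
    moreover have "y \<in> green_L S m `` {x}" "x \<in> green_L S m `` {y}"
      using L green_L_sym[OF L] by auto
    ultimately show "x \<in> S - N \<and> y \<in> S - N"
      using triv by (metis DiffI singletonD)
  qed
  ultimately have "(a, b) \<in> ?E"
    using D by (auto simp: green_D_def)
  then show "(a, b) \<in> ?R" using \<open>a \<in> N\<close> by auto
qed (use green_R_subset_green_D in blast)

section \<open>The Brandt semigroup\<close>

lemma brandt_add_zero [simp]: "x +\<^sub>B \<vartheta> = \<vartheta>"
  by (cases x) auto

lemma brandt_add_assoc: "(x +\<^sub>B y) +\<^sub>B z = x +\<^sub>B (y +\<^sub>B z)"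
  by (cases x; cases y; cases z) auto

lemma brandt_add_eq_Some_iff:
  "x +\<^sub>B y = Some (i, l) \<longleftrightarrow> (\<exists>j. x = Some (i, j) \<and> y = Some (j, l))"
  by (cases x; cases y) (auto split: if_splits)

lemma zero_in_carrier [simp]: "\<vartheta> \<in> brandt_carrier n"
  and Some_in_carrier [simp]:
    "Some (i, j) \<in> brandt_carrier n \<longleftrightarrow> i \<in> {1..n} \<and> j \<in> {1..n}"
  by (auto simp: brandt_carrier_def)

lemma brandt_add_in_carrier:
  "x \<in> brandt_carrier n \<Longrightarrow> y \<in> brandt_carrier n \<Longrightarrow> x +\<^sub>B y \<in> brandt_carrier n"
  by (auto simp: brandt_carrier_def)

lemma card_brandt_carrier: "card (brandt_carrier n) = Suc (n * n)"
  by (simp add: brandt_carrier_def card_image card_insert_if)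

section \<open>Endomorphisms of the Brandt semigroup\<close>

lemma endo_add:
  "\<lbrakk>g \<in> brandt_endos n; x \<in> brandt_carrier n; y \<in> brandt_carrier n\<rbrakk>
    \<Longrightarrow> g (x +\<^sub>B y) = g x +\<^sub>B g y"
  by (simp add: brandt_endos_def)

text \<open>Since \<vartheta> absorbs \<open>x\<close> on both sides, \<open>g x\<close> acts as a
  two-sided identity on the nonzero idempotent \<open>g \<vartheta>\<close>. An idempotent
  \<open>(p, p)\<close> admits only itself in that role.\<close>

lemma endo_constant_if_nonzero_at_zero:
  assumes "g \<in> brandt_endos n" "g \<vartheta> \<noteq> \<vartheta>" "x \<in> brandt_carrier n"
  shows "g x = g \<vartheta>"
proof -
  have "g \<vartheta> = g \<vartheta> +\<^sub>B g \<vartheta>" "g \<vartheta> = g x +\<^sub>B g \<vartheta>" "g \<vartheta> = g \<vartheta> +\<^sub>B g x"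
    using endo_add[OF assms(1), of \<vartheta> \<vartheta>] endo_add[OF assms(1), of x \<vartheta>]
      endo_add[OF assms(1), of \<vartheta> x] assms(3) by simp_all
  with assms(2) show ?thesis
    by (cases "g \<vartheta>"; cases "g x") (auto split: if_splits)
qed

text \<open>Let \<open>x = (i, j)\<close>, \<open>y = (k, l)\<close>. If \<open>i\<close> and
  \<open>k\<close> differ, adding \<open>(j, i)\<close> on the left sends \<open>x\<close> to
  \<open>(j, j)\<close> but \<open>y\<close> to \<vartheta>. Hence \<open>g\<close> kills
  \<open>(j, j)\<close>, a right identity for \<open>x\<close>, and so kills \<open>x\<close>.
  Second coordinates are compared by the mirror argument.\<close>

lemma endo_inj_on_nonzero:
  assumes g: "g \<in> brandt_endos n" and g0: "g \<vartheta> = \<vartheta>"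
    and x: "x \<in> brandt_carrier n" and y: "y \<in> brandt_carrier n"
    and eq: "g x = g y" and nz: "g x \<noteq> \<vartheta>"
  shows "x = y"
proof -
  obtain i j where xi: "x = Some (i, j)" using nz g0 by (cases x) auto
  obtain k l where yk: "y = Some (k, l)" using nz eq g0 by (cases y) auto
  have ij: "i \<in> {1..n}" "j \<in> {1..n}" using x xi by auto
  have "i = k"
  proof (rule ccontr)
    assume "i \<noteq> k"
    have "g (Some (j, j)) = g (Some (j, i)) +\<^sub>B g y"
      using endo_add[OF g, of "Some (j, i)" x] x ij xi eq by simp
    also have "\<dots> = \<vartheta>"
      using endo_add[OF g, of "Some (j, i)" y] y ij yk g0 \<open>i \<noteq> k\<close> by simp
    finally show False
      using endo_add[OF g, of x "Some (j, j)"] x ij xi nz by simp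
  qed
  moreover have "j = l"
  proof (rule ccontr)
    assume "j \<noteq> l"
    have "g (Some (i, i)) = g y +\<^sub>B g (Some (j, i))"
      using endo_add[OF g, of x "Some (j, i)"] x ij xi eq by simp
    also have "\<dots> = \<vartheta>"
      using endo_add[OF g, of y "Some (j, i)"] y ij yk g0 \<open>j \<noteq> l\<close> by simp
    finally show False
      using endo_add[OF g, of "Some (i, i)" x] x ij xi nz by simp
  qed
  ultimately show ?thesis using xi yk by simp
qed

section \<open>The affine near-semiring\<close>

abbreviation const_map :: "nat \<Rightarrow> brandt \<Rightarrow> brandt \<Rightarrow> brandt"
  where "const_map n c \<equiv> (\<lambda>\<alpha>\<in>brandt_carrier n. c)"

lemma ptwise_add_apply:
  "x \<in> brandt_carrier n \<Longrightarrow> ptwise_add n f g x = f x +\<^sub>B g x"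
  by (simp add: ptwise_add_def)

lemma left_comp_apply:
  "x \<in> brandt_carrier n \<Longrightarrow> left_comp n f g x = g (f x)"
  by (simp add: left_comp_def compose_def)

lemma ptwise_add_assoc:
  "ptwise_add n (ptwise_add n f g) h = ptwise_add n f (ptwise_add n g h)"
  by (auto simp: ptwise_add_def brandt_add_assoc restrict_def)

lemma brandt_maps_apply:
  "f \<in> brandt_maps n \<Longrightarrow> x \<in> brandt_carrier n \<Longrightarrow> f x \<in> brandt_carrier n"
  by (auto simp: brandt_maps_def)

lemma brandt_maps_eqI:
  assumes "f \<in> brandt_maps n" "g \<in> brandt_maps n"
    and "\<And>x. x \<in> brandt_carrier n \<Longrightarrow> f x = g x"
  shows "f = g"
  using assms unfolding brandt_maps_def by (blast intro: PiE_ext)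

lemma const_map_in_brandt_maps: "c \<in> brandt_carrier n \<Longrightarrow> const_map n c \<in> brandt_maps n"
  by (auto simp: brandt_maps_def)

lemma ptwise_add_in_brandt_maps:
  "f \<in> brandt_maps n \<Longrightarrow> g \<in> brandt_maps n \<Longrightarrow> ptwise_add n f g \<in> brandt_maps n"
  by (auto simp: ptwise_add_def brandt_maps_def intro!: brandt_add_in_carrier)

lemma left_comp_in_brandt_maps:
  "f \<in> brandt_maps n \<Longrightarrow> g \<in> brandt_maps n \<Longrightarrow> left_comp n f g \<in> brandt_maps n"
  by (auto simp: left_comp_def compose_def brandt_maps_def)

text \<open>The constant \<open>(p, p)\<close> is an endomorphism because its value is idempotent;
  adding the constant \<open>(p, q)\<close> to it gives \<open>(p, q)\<close> again.\<close>

lemma const_map_in_affine_nsr: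
  assumes "p \<in> {1..n}" "q \<in> {1..n}"
  shows "const_map n (Some (p, q)) \<in> affine_nsr n"
proof (rule affine_nsr.affine)
  have "const_map n (Some (p, p)) \<in> brandt_endos n"
    using assms by (auto simp: brandt_endos_def const_map_in_brandt_maps brandt_add_in_carrier)
  moreover have "const_map n (Some (p, q)) \<in> constant_maps n"
    using assms by (auto simp: constant_maps_def)
  moreover have "const_map n (Some (p, q))
      = ptwise_add n (const_map n (Some (p, p))) (const_map n (Some (p, q)))"
    by (auto simp: ptwise_add_def)
  ultimately show "const_map n (Some (p, q)) \<in> affine_maps n"
    unfolding affine_maps_def by blast
qed

text \<open>For a map into \<open>B\<^sub>n\<close>, this says that the support is sent injectively
  into a single column \<open>[n] \<times> {q}\<close>. The zero map is included, as any
  \<open>q\<close> serves on an empty support.\<close>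

definition rank_one :: "nat \<Rightarrow> (brandt \<Rightarrow> brandt) \<Rightarrow> bool"
  where "rank_one n f \<longleftrightarrow> f \<vartheta> = \<vartheta> \<and>
    (\<exists>q. \<forall>x\<in>supp n f. snd (the (f x)) = q) \<and> inj_on (\<lambda>x. fst (the (f x))) (supp n f)"

lemma rank_oneI:
  assumes "f \<vartheta> = \<vartheta>"
    and "\<And>x i j. x \<in> brandt_carrier n \<Longrightarrow> f x = Some (i, j) \<Longrightarrow> j = q"
    and "\<And>x y i j k. \<lbrakk>x \<in> brandt_carrier n; y \<in> brandt_carrier n;
           f x = Some (i, j); f y = Some (i, k)\<rbrakk> \<Longrightarrow> x = y"
  shows "rank_one n f"
proof -
  have "\<exists>q. \<forall>x\<in>supp n f. snd (the (f x)) = q"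
    using assms(2) by (fastforce simp: supp_def)
  moreover have "inj_on (\<lambda>x. fst (the (f x))) (supp n f)"
    using assms(3) by (fastforce simp: supp_def intro!: inj_onI)
  ultimately show ?thesis using assms(1) by (auto simp: rank_one_def)
qed

lemma rank_oneE:
  assumes "rank_one n f"
  obtains q where "f \<vartheta> = \<vartheta>"
    and "\<And>x i j. x \<in> brandt_carrier n \<Longrightarrow> f x = Some (i, j) \<Longrightarrow> j = q"
    and "\<And>x y i j k. \<lbrakk>x \<in> brandt_carrier n; y \<in> brandt_carrier n;
           f x = Some (i, j); f y = Some (i, k)\<rbrakk> \<Longrightarrow> x = y"
proof -
  from assms obtain q where q: "\<forall>x\<in>supp n f. snd (the (f x)) = q" and f0: "f \<vartheta> = \<vartheta>"
    and inj: "inj_on (\<lambda>x. fst (the (f x))) (supp n f)"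
    by (auto simp: rank_one_def)
  show thesis
  proof (rule that[of q])
    show "f \<vartheta> = \<vartheta>" by fact
    show "j = q" if "x \<in> brandt_carrier n" "f x = Some (i, j)" for x i j
      using q that by (auto simp: supp_def)
    show "x = y" if "x \<in> brandt_carrier n" "y \<in> brandt_carrier n"
      "f x = Some (i, j)" "f y = Some (i, k)" for x y i j k
      using inj_onD[OF inj, of x y] that by (auto simp: supp_def)
  qed
qed

definition const_or_rank_one :: "nat \<Rightarrow> (brandt \<Rightarrow> brandt) \<Rightarrow> bool"
  where "const_or_rank_one n f \<longleftrightarrow> f \<in> brandt_maps n \<and>
    ((\<exists>c. \<forall>x\<in>brandt_carrier n. f x = c) \<or> rank_one n f)"

text \<open>An endomorphism that moves \<vartheta> is constant. Otherwise the added constant fixes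
  the second coordinate, and injectivity on nonzero values is inherited from the
  endomorphism.\<close>

lemma const_or_rank_one_affine:
  assumes "f \<in> affine_maps n"
  shows "const_or_rank_one n f"
proof -
  from assms obtain g c where g: "g \<in> brandt_endos n" and c: "c \<in> brandt_carrier n"
    and f: "f = ptwise_add n g (const_map n c)"
    by (auto simp: affine_maps_def constant_maps_def)
  have "f \<in> brandt_maps n"
    using g c f by (auto simp: brandt_endos_def intro!: ptwise_add_in_brandt_maps const_map_in_brandt_maps)
  moreover have fx: "f x = g x +\<^sub>B c" if "x \<in> brandt_carrier n" for x
    using that f by (simp add: ptwise_add_apply)
  moreover have "(\<exists>d. \<forall>x\<in>brandt_carrier n. f x = d) \<or> rank_one n f"
  proof (cases "g \<vartheta> = \<vartheta>")
    case False
    then show ?thesis using endo_constant_if_nonzero_at_zero[OF g] fx by metis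
  next
    case True
    have "rank_one n f"
    \<comment> \<open>If \<open>c\<close> is \<vartheta>, then \<open>f\<close> has no nonzero value
      and this unspecified coordinate is never compared.\<close>
    proof (rule rank_oneI[where q = "snd (the c)"])
      show "f \<vartheta> = \<vartheta>" using fx True by simp
      show "j = snd (the c)" if "x \<in> brandt_carrier n" "f x = Some (i, j)" for x i j
        using that fx[of x] by (auto simp: brandt_add_eq_Some_iff)
      show "x = y" if xy: "x \<in> brandt_carrier n" "y \<in> brandt_carrier n"
        "f x = Some (i, j)" "f y = Some (i, k)" for x y i j k
      proof (rule endo_inj_on_nonzero[OF g True xy(1,2)])
        \<comment> \<open>A nonzero sum forces the second coordinate of \<open>g x\<close> and of
          \<open>g y\<close> to be the first coordinate \<open>p\<close> of
          \<open>c\<close>.\<close>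
        obtain p where "g x = Some (i, p)" "g y = Some (i, p)"
          using xy fx[of x] fx[of y]
          by (auto simp: brandt_add_eq_Some_iff)
        then show "g x = g y" "g x \<noteq> \<vartheta>" by auto
      qed
    qed
    then show ?thesis ..
  qed
  ultimately show ?thesis by (simp add: const_or_rank_one_def)
qed

text \<open>A nonzero sum takes its first coordinate from the left summand and its second from the
  right one. So injectivity comes from \<open>f\<close> and the common column from
  \<open>g\<close>.\<close>

lemma rank_one_add:
  assumes "rank_one n f"
    and "(\<exists>c. \<forall>x\<in>brandt_carrier n. g x = c) \<or> rank_one n g"
  shows "rank_one n (ptwise_add n f g)"
proof -
  have "\<exists>q. \<forall>x\<in>brandt_carrier n. \<forall>i j. g x = Some (i, j) \<longrightarrow> j = q"
    using assms(2) by (metis Pair_inject option.inject rank_oneE)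
  then obtain q where q: "\<And>x i j. x \<in> brandt_carrier n \<Longrightarrow> g x = Some (i, j) \<Longrightarrow> j = q"
    by blast
  have f: "f \<vartheta> = \<vartheta>"
    "\<And>x y i j k. \<lbrakk>x \<in> brandt_carrier n; y \<in> brandt_carrier n;
           f x = Some (i, j); f y = Some (i, k)\<rbrakk> \<Longrightarrow> x = y"
    using assms(1) by (elim rank_oneE; blast)+
  have sum: "\<exists>k. f x = Some (i, k) \<and> g x = Some (k, j)"
    if "x \<in> brandt_carrier n" "ptwise_add n f g x = Some (i, j)" for x i j
    using that by (simp add: ptwise_add_apply brandt_add_eq_Some_iff)
  show ?thesis
  proof (rule rank_oneI[where q = q])
    show "ptwise_add n f g \<vartheta> = \<vartheta>" using f(1) by (simp add: ptwise_add_apply)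
    show "j = q" if "x \<in> brandt_carrier n" "ptwise_add n f g x = Some (i, j)" for x i j
      using sum[OF that] q that(1) by blast
    show "x = y" if "x \<in> brandt_carrier n" "y \<in> brandt_carrier n"
      "ptwise_add n f g x = Some (i, j)" "ptwise_add n f g y = Some (i, k)" for x y i j k
      using sum[OF that(1,3)] sum[OF that(2,4)] f(2)[OF that(1,2)] by blast
  qed
qed

text \<open>All nonzero sums share the first coordinate of \<open>c\<close>, so injectivity requires
  a support of at most one point. This holds because the first coordinate of \<open>g x\<close> must
  match the second of \<open>c\<close>, which determines \<open>x\<close>.\<close>

lemma const_add_rank_one:
  assumes "\<forall>x\<in>brandt_carrier n. f x = c" "rank_one n g"
  shows "rank_one n (ptwise_add n f g)"
proof -
  obtain q where g: "g \<vartheta> = \<vartheta>"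
    "\<And>x i j. x \<in> brandt_carrier n \<Longrightarrow> g x = Some (i, j) \<Longrightarrow> j = q"
    "\<And>x y i j k. \<lbrakk>x \<in> brandt_carrier n; y \<in> brandt_carrier n;
           g x = Some (i, j); g y = Some (i, k)\<rbrakk> \<Longrightarrow> x = y"
    using assms(2) by (rule rank_oneE) (rule that)
  have sum: "\<exists>k. c = Some (i, k) \<and> g x = Some (k, j)"
    if "x \<in> brandt_carrier n" "ptwise_add n f g x = Some (i, j)" for x i j
    using that assms(1) by (simp add: ptwise_add_apply brandt_add_eq_Some_iff)
  show ?thesis
  proof (rule rank_oneI[where q = q])
    show "ptwise_add n f g \<vartheta> = \<vartheta>" using g(1) by (simp add: ptwise_add_apply)
    show "j = q" if "x \<in> brandt_carrier n" "ptwise_add n f g x = Some (i, j)" for x i j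
      using sum[OF that] g(2) that(1) by blast
    show "x = y" if "x \<in> brandt_carrier n" "y \<in> brandt_carrier n"
      "ptwise_add n f g x = Some (i, j)" "ptwise_add n f g y = Some (i, k)" for x y i j k
      using sum[OF that(1,3)] sum[OF that(2,4)] g(3)[OF that(1,2)] by auto
  qed
qed

text \<open>The first coordinate of \<open>g (f x)\<close> determines \<open>f x\<close>, which in
  turn determines \<open>x\<close>; the column is that of \<open>g\<close>.\<close>

lemma rank_one_comp:
  assumes "f \<in> brandt_maps n" "rank_one n f" "rank_one n g"
  shows "rank_one n (left_comp n f g)"
proof -
  obtain p where f: "f \<vartheta> = \<vartheta>"
    "\<And>x i j. x \<in> brandt_carrier n \<Longrightarrow> f x = Some (i, j) \<Longrightarrow> j = p"
    "\<And>x y i j k. \<lbrakk>x \<in> brandt_carrier n; y \<in> brandt_carrier n;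
           f x = Some (i, j); f y = Some (i, k)\<rbrakk> \<Longrightarrow> x = y"
    using assms(2) by (rule rank_oneE) (rule that)
  obtain q where g: "g \<vartheta> = \<vartheta>"
    "\<And>x i j. x \<in> brandt_carrier n \<Longrightarrow> g x = Some (i, j) \<Longrightarrow> j = q"
    "\<And>x y i j k. \<lbrakk>x \<in> brandt_carrier n; y \<in> brandt_carrier n;
           g x = Some (i, j); g y = Some (i, k)\<rbrakk> \<Longrightarrow> x = y"
    using assms(3) by (rule rank_oneE) (rule that)
  note fc = brandt_maps_apply[OF assms(1)]
  show ?thesis
  proof (rule rank_oneI[where q = q])
    show "left_comp n f g \<vartheta> = \<vartheta>" using f(1) g(1) by (simp add: left_comp_apply)
    show "j = q" if "x \<in> brandt_carrier n" "left_comp n f g x = Some (i, j)" for x i j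
      using that g(2)[of "f x"] fc by (auto simp: left_comp_apply)
    show "x = y" if x: "x \<in> brandt_carrier n" and y: "y \<in> brandt_carrier n"
      and "left_comp n f g x = Some (i, j)" "left_comp n f g y = Some (i, k)" for x y i j k
    proof -
      have eq: "f x = f y"
        using that g(3)[of "f x" "f y"] fc by (auto simp: left_comp_apply)
      \<comment> \<open>Since \<open>g\<close> fixes \<vartheta>, a nonzero composite value needs a
        nonzero inner value, where injectivity of \<open>f\<close> applies.\<close>
      have "f x \<noteq> \<vartheta>"
        using that g(1) by (metis left_comp_apply option.distinct(1))
      then obtain a b where "f x = Some (a, b)" by auto
      then show ?thesis using f(3)[OF x y, of a b b] eq by simp
    qed
  qed
qed

text \<open>The dichotomy passes through both operations. A sum is split by its left summand, and a
  composite is constant as soon as one factor is.\<close>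

lemma affine_nsr_const_or_rank_one:
  assumes "f \<in> affine_nsr n"
  shows "const_or_rank_one n f"
  using assms
proof induction
  case (affine f)
  then show ?case by (rule const_or_rank_one_affine)
next
  case (add f g)
  then have maps: "f \<in> brandt_maps n" "g \<in> brandt_maps n"
    by (auto simp: const_or_rank_one_def)
  consider (cc) "\<exists>c. \<forall>x\<in>brandt_carrier n. f x = c" "\<exists>c. \<forall>x\<in>brandt_carrier n. g x = c"
    | (cr) "\<exists>c. \<forall>x\<in>brandt_carrier n. f x = c" "rank_one n g"
    | (r) "rank_one n f" "(\<exists>c. \<forall>x\<in>brandt_carrier n. g x = c) \<or> rank_one n g"
    using add.IH by (auto simp: const_or_rank_one_def)
  then have "(\<exists>c. \<forall>x\<in>brandt_carrier n. ptwise_add n f g x = c) \<or> rank_one n (ptwise_add n f g)"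
  proof cases
    case cc
    then show ?thesis by (auto simp: ptwise_add_apply)
  next
    case cr
    then show ?thesis using const_add_rank_one by blast
  next
    case r
    then show ?thesis using rank_one_add by blast
  qed
  then show ?case using maps by (simp add: const_or_rank_one_def ptwise_add_in_brandt_maps)
next
  case (comp f g)
  then have maps: "f \<in> brandt_maps n" "g \<in> brandt_maps n"
    by (auto simp: const_or_rank_one_def)
  consider (cf) "\<exists>c. \<forall>x\<in>brandt_carrier n. f x = c" | (cg) "\<exists>c. \<forall>x\<in>brandt_carrier n. g x = c"
    | (r) "rank_one n f" "rank_one n g"
    using comp.IH by (auto simp: const_or_rank_one_def)
  then have "(\<exists>c. \<forall>x\<in>brandt_carrier n. left_comp n f g x = c) \<or> rank_one n (left_comp n f g)"
  proof cases
    case cf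
    then show ?thesis by (auto simp: left_comp_apply)
  next
    case cg
    then show ?thesis using brandt_maps_apply[OF maps(1)] by (auto simp: left_comp_apply)
  next
    case r
    then show ?thesis using rank_one_comp maps by blast
  qed
  then show ?case using maps by (simp add: const_or_rank_one_def left_comp_in_brandt_maps)
qed

section \<open>Consequences of the dichotomy for coordinates and supports\<close>

lemma affine_nsr_in_brandt_maps: "f \<in> affine_nsr n \<Longrightarrow> f \<in> brandt_maps n"
  using affine_nsr_const_or_rank_one by (auto simp: const_or_rank_one_def)

lemma affine_nsr_snd_constant:
  assumes "f \<in> affine_nsr n"
  shows "\<exists>q. \<forall>x\<in>supp n f. snd (the (f x)) = q"
  using affine_nsr_const_or_rank_one[OF assms]
  by (auto simp: const_or_rank_one_def rank_one_def supp_def)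

text \<open>A constant map has support of size 0 or \<open>n * n + 1\<close>, neither of which
  equals \<open>n\<close>, so only the rank-one alternative remains.\<close>

lemma affine_nsr_supp_fst_inj:
  assumes "n \<ge> 1" "f \<in> affine_nsr_supp n n"
  shows "inj_on (\<lambda>x. fst (the (f x))) (supp n f)"
proof -
  have "\<not> (\<forall>x\<in>brandt_carrier n. f x = c)" for c
  proof
    assume "\<forall>x\<in>brandt_carrier n. f x = c"
    then have "supp n f = (if c = \<vartheta> then {} else brandt_carrier n)"
      by (auto simp: supp_def)
    then have "n = 0 \<or> n = Suc (n * n)"
      using assms(2) by (auto simp: affine_nsr_supp_def card_brandt_carrier split: if_splits)
    moreover have "n \<le> n * n" by simp
    ultimately show False using assms(1) by linarith
  qed
  then show ?thesis
    using affine_nsr_const_or_rank_one[of f n] assms(2)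
    by (auto simp: affine_nsr_supp_def const_or_rank_one_def rank_one_def)
qed

section \<open>Green's relations on the affine near-semiring\<close>

lemma affine_nsr_green_R_iff:
  "(f, g) \<in> green_R (affine_nsr n) (ptwise_add n) \<longleftrightarrow> f \<in> affine_nsr n \<and> g \<in> affine_nsr n \<and>
    (f = g \<or> (\<exists>s\<in>affine_nsr n. \<exists>t\<in>affine_nsr n. g = ptwise_add n f s \<and> f = ptwise_add n g t))"
  by (rule green_R_iff) (auto intro: affine_nsr.add ptwise_add_assoc)

lemma supp_eqD:
  "supp n f = supp n g \<Longrightarrow> x \<in> brandt_carrier n \<Longrightarrow> f x = \<vartheta> \<longleftrightarrow> g x = \<vartheta>"
  unfolding supp_def by blast

lemma supp_ptwise_add: "supp n (ptwise_add n f g) \<subseteq> supp n f \<inter> supp n g"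
  by (auto simp: supp_def ptwise_add_apply brandt_add_eq_Some_iff)

lemma fst_ptwise_add:
  "x \<in> supp n (ptwise_add n f g) \<Longrightarrow> fst (the (ptwise_add n f g x)) = fst (the (f x))"
  by (auto simp: supp_def ptwise_add_apply brandt_add_eq_Some_iff)

text \<open>Adding on the right can only shrink the support and preserves first coordinates on what
  remains; mutual right multiples therefore agree in both.\<close>

lemma affine_nsr_green_R_supp:
  assumes "(f, g) \<in> green_R (affine_nsr n) (ptwise_add n)"
  shows "supp n f = supp n g" "\<forall>x\<in>supp n f. fst (the (f x)) = fst (the (g x))"
proof -
  have *: "f = g \<or> (\<exists>s t. g = ptwise_add n f s \<and> f = ptwise_add n g t)"
    using assms unfolding affine_nsr_green_R_iff by blast
  then show supp: "supp n f = supp n g"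
    by (metis subset_antisym le_infE supp_ptwise_add)
  show "\<forall>x\<in>supp n f. fst (the (f x)) = fst (the (g x))"
    using * fst_ptwise_add[of _ n] supp by metis
qed

text \<open>With constant second coordinates \<open>q\<close> of \<open>f\<close> and
  \<open>r\<close> of \<open>g\<close>, the identity \<open>(i, q) + (q, r) = (i, r)\<close> makes
  the constant \<open>(q, r)\<close> the required summand.\<close>

lemma affine_nsr_right_multiple:
  assumes f: "f \<in> affine_nsr n" and g: "g \<in> affine_nsr n" and ne: "supp n f \<noteq> {}"
    and supp: "supp n f = supp n g"
    and fst: "\<forall>x\<in>supp n f. fst (the (f x)) = fst (the (g x))"
  shows "\<exists>s\<in>affine_nsr n. g = ptwise_add n f s"
proof -
  note maps = affine_nsr_in_brandt_maps[OF f] affine_nsr_in_brandt_maps[OF g]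
  obtain q where q: "\<forall>x\<in>supp n f. snd (the (f x)) = q"
    using affine_nsr_snd_constant[OF f] by blast
  obtain r where r: "\<forall>x\<in>supp n g. snd (the (g x)) = r"
    using affine_nsr_snd_constant[OF g] by blast
  have val: "\<exists>i. f x = Some (i, q) \<and> g x = Some (i, r)" if "x \<in> supp n f" for x
  proof -
    have x: "x \<in> supp n g" using that supp by simp
    then have "f x \<noteq> \<vartheta>" "g x \<noteq> \<vartheta>" using that by (simp_all add: supp_def)
    then obtain i j k l where "f x = Some (i, j)" "g x = Some (k, l)" by auto
    with x that q r fst show ?thesis by (metis fst_conv option.sel snd_conv)
  qed
  \<comment> \<open>One support point shows that \<open>q\<close> and \<open>r\<close> lie in
    \<open>[n]\<close>, so that the constant map belongs to
    \<open>A\<^sup>+(B\<^sub>n)\<close>.\<close>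
  obtain x i where x: "x \<in> brandt_carrier n" "f x = Some (i, q)" "g x = Some (i, r)"
  proof -
    obtain x where "x \<in> supp n f" using ne by blast
    then show thesis using val[of x] that by (auto simp: supp_def)
  qed
  then have qr: "q \<in> {1..n}" "r \<in> {1..n}"
    using brandt_maps_apply[OF maps(1) x(1)] brandt_maps_apply[OF maps(2) x(1)] by auto
  have s: "const_map n (Some (q, r)) \<in> affine_nsr n"
    using const_map_in_affine_nsr[OF qr] .
  have "g = ptwise_add n f (const_map n (Some (q, r)))"
  proof (rule brandt_maps_eqI[OF maps(2)])
    show "ptwise_add n f (const_map n (Some (q, r))) \<in> brandt_maps n"
      using affine_nsr.add[OF f s] by (rule affine_nsr_in_brandt_maps)
    fix y assume y: "y \<in> brandt_carrier n"
    show "g y = ptwise_add n f (const_map n (Some (q, r))) y"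
    proof (cases "y \<in> supp n f")
      case True
      then show ?thesis using val[OF True] y by (auto simp: ptwise_add_apply)
    next
      case False
      then have fy: "f y = \<vartheta>" using y unfolding supp_def by blast
      then have "g y = \<vartheta>" using supp_eqD[OF supp y] by simp
      then show ?thesis using fy y by (simp add: ptwise_add_apply)
    qed
  qed
  then show ?thesis using s by blast
qed

lemma affine_nsr_supp_green_L_trivial:
  assumes "n \<ge> 1" and f: "f \<in> affine_nsr_supp n n"
    and L: "(f, h) \<in> green_L (affine_nsr n) (ptwise_add n)"
  shows "h = f"
proof (rule ccontr)
  assume "h \<noteq> f"
  then obtain s t where s: "s \<in> affine_nsr n" and h: "h = ptwise_add n s f"
    and ft: "f = ptwise_add n t h" and hA: "h \<in> affine_nsr n"
    using green_LD[OF L] by blast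
  have fA: "f \<in> affine_nsr n" and card: "card (supp n f) = n"
    using f by (auto simp: affine_nsr_supp_def)
  \<comment> \<open>Each of \<open>f\<close> and \<open>h\<close> is a left multiple of the other,
    so each support contains the other.\<close>
  have supp: "supp n h = supp n f"
    using h ft by (metis subset_antisym le_infE supp_ptwise_add)
  obtain q where q: "\<forall>x\<in>supp n s. snd (the (s x)) = q"
    using affine_nsr_snd_constant[OF s] by blast
  have fst_f: "fst (the (f x)) = q" if "x \<in> supp n f" for x
  proof -
    have x: "x \<in> brandt_carrier n" "h x \<noteq> \<vartheta>"
      using that unfolding supp[symmetric] by (simp_all add: supp_def)
    then have "s x +\<^sub>B f x \<noteq> \<vartheta>" using h by (simp add: ptwise_add_apply)
    then show ?thesis
      using q x by (auto simp: supp_def brandt_add_eq_Some_iff)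
  qed
  \<comment> \<open>The \<open>n\<close> support points have distinct first coordinates, yet all of
    these equal \<open>q\<close>.\<close>
  have "card (supp n f) = card ((\<lambda>x. fst (the (f x))) ` supp n f)"
    using affine_nsr_supp_fst_inj[OF assms(1) f] by (simp add: card_image)
  also have "\<dots> \<le> card {q}"
    by (rule card_mono) (auto simp: fst_f)
  finally have n: "n = 1" using card assms(1) by simp
  \<comment> \<open>Over \<open>B\<^sub>1\<close> the only nonzero value is \<open>(1, 1)\<close>,
    so a map is determined by its support.\<close>
  have "h = f"
  proof (rule brandt_maps_eqI)
    show maps: "h \<in> brandt_maps n" "f \<in> brandt_maps n"
      using hA fA by (auto intro: affine_nsr_in_brandt_maps)
    fix x assume x: "x \<in> brandt_carrier n"
    have "f x = \<vartheta> \<longleftrightarrow> h x = \<vartheta>" using supp_eqD[OF supp x] by simp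
    then show "h x = f x"
      using brandt_maps_apply[OF maps(1) x] brandt_maps_apply[OF maps(2) x] n
      by (auto simp: brandt_carrier_def)
  qed
  with \<open>h \<noteq> f\<close> show False ..
qed

theorem theorem3p7:
  fixes n :: nat and f g :: "brandt \<Rightarrow> brandt"
  assumes "n \<ge> 1"
    and "f \<in> affine_nsr_supp n n"
    and "g \<in> affine_nsr_supp n n"
  shows "((f, g) \<in> green_R (affine_nsr n) (ptwise_add n) \<longleftrightarrow>
           supp n f = supp n g \<and>
           (\<forall>\<alpha>\<in>supp n f. fst (the (f \<alpha>)) = fst (the (g \<alpha>))))
       \<and> green_L (affine_nsr n) (ptwise_add n) `` {f} = {f}
       \<and> ((f, g) \<in> green_D (affine_nsr n) (ptwise_add n) \<longleftrightarrow>
           (f, g) \<in> green_R (affine_nsr n) (ptwise_add n))"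
proof (intro conjI)
  let ?R = "green_R (affine_nsr n) (ptwise_add n)"
  have A: "f \<in> affine_nsr n" "g \<in> affine_nsr n" and card: "card (supp n f) = n"
    using assms by (auto simp: affine_nsr_supp_def)
  then have ne: "supp n f \<noteq> {}" using assms(1) by auto
  show "(f, g) \<in> ?R \<longleftrightarrow> supp n f = supp n g \<and>
           (\<forall>\<alpha>\<in>supp n f. fst (the (f \<alpha>)) = fst (the (g \<alpha>)))" (is "_ \<longleftrightarrow> ?agree")
  proof
    show "?agree" if "(f, g) \<in> ?R"
      using affine_nsr_green_R_supp[OF that] by blast
    show "(f, g) \<in> ?R" if agree: "?agree"
    proof -
      have "\<exists>s\<in>affine_nsr n. g = ptwise_add n f s"
        using agree affine_nsr_right_multiple[OF A ne] by blast
      moreover have "\<exists>t\<in>affine_nsr n. f = ptwise_add n g t"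
        using agree ne by (intro affine_nsr_right_multiple[OF A(2,1)]) auto
      ultimately show ?thesis
        using A unfolding affine_nsr_green_R_iff by blast
    qed
  qed
  have L: "green_L (affine_nsr n) (ptwise_add n) `` {a} = {a}" if "a \<in> affine_nsr_supp n n" for a
    using affine_nsr_supp_green_L_trivial[OF assms(1) that] that
    by (auto simp: green_L_def affine_nsr_supp_def)
  show "green_L (affine_nsr n) (ptwise_add n) `` {f} = {f}"
    using L assms(2) .
  show "(f, g) \<in> green_D (affine_nsr n) (ptwise_add n) \<longleftrightarrow> (f, g) \<in> ?R"
  \<comment> \<open>The elements of support size \<open>n\<close> form an \<R>-saturated set because
    \<R> preserves supports.\<close>
  proof (rule green_D_eq_green_R_if_green_L_trivial[where N = "affine_nsr_supp n n"])
    show "a \<in> affine_nsr_supp n n \<longleftrightarrow> b \<in> affine_nsr_supp n n" if "(a, b) \<in> ?R" for a b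
      using affine_nsr_green_R_supp(1)[OF that] that
      by (auto simp: affine_nsr_supp_def green_R_def)
  qed (use assms(2) L in auto)
qed

end
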